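(* Fix an integer $k\ge 1$ and let $\alpha = 3/2+1/k$. There exists an offline algorithm $\mathrm{OFF}\in\mathcal{A}^k_\alpha$ such that for every request sequence $\sigma$ (with ring demands), $\mathrm{OFF}(\sigma)\le O(k)\cdot \mathrm{OPT}(\sigma)+O(n)$, i.e., there are absolute constants $C_1,C_2$ with $\mathrm{OFF}(\sigma)\le C_1 k\cdot\mathrm{OPT}(\sigma)+C_2 n$ for all $\sigma$.
   Context: Online bisection with ring demands: $n$ nodes $v_1,\dots,v_n$ ($n$ even) on a cycle with edges $(v_1,v_2),\dots,(v_n,v_1)$. An algorithm maintains a red/blue coloring of the nodes, starting from a fixed initial coloring with $n/2$ nodes of each color. Each request is a cycle edge; the algorithm pays $1$ if its endpoints have different colors (hit cost), then may recolor nodes at cost $1$ per node. $\mathrm{ALG}(\sigma)$ is the total cost on $\sigma$. A coloring is $\alpha$-balanced if each color is used on at most $\alpha n/2$ nodes; an algorithm is $\alpha$-augmented if after each request's recoloring its coloring is $\alpha$-balanced. $\mathrm{OPT}(\sigma)$ is the optimal offline cost among algorithms maintaining a $1$-balanced coloring. The cut-edges of a coloring are the cycle edges whose endpoints have different colors; any even-size set of cycle edges induces a coloring (up to swapping colors) having exactly those cut-edges. Global rebalancing: given a valid set $\mathcal{C}$ of cut-edges inducing a $1$-balanced coloring, a fixed deterministic procedure computes $\mathcal{C}_{2k}\subseteq\mathcal{C}$ with $|\mathcal{C}_{2k}|=\min\{2k,|\mathcal{C}|\}$ inducing a $(1+1/k)$-balanced coloring (e.g., while more than $2k$ cut-edges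 remain, recolor the smallest maximal monochromatic arc of the currently more frequent color). For $k\ge1$ and $\alpha\ge 1+1/k$, $\mathcal{A}^k_\alpha$ is the class of (online or offline) algorithms that (i) are $\alpha$-augmented, (ii) before processing the input replace the initial coloring by the coloring induced by applying the global rebalancing procedure to the cut-edges of the initial coloring, and (iii) at all times have at most $2k$ cut-edges. *)

theory Defs
  imports Complex_Main
begin

text \<open>
  The nodes of the cycle are \<open>0, \<dots>, n - 1\<close>; the edge with index \<open>i < n\<close> joins
  \<open>i\<close> and \<open>Suc i mod n\<close>. A colouring is read only on the nodes \<open>i < n\<close>;
  \<open>True\<close> stands for red and \<open>False\<close> for blue.
\<close>

type_synonym coloring = "nat \<Rightarrow> bool"

definition cut_edges :: "nat \<Rightarrow> coloring \<Rightarrow> nat set" where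
  "cut_edges n c = {i. i < n \<and> c i \<noteq> c (Suc i mod n)}"

definition balanced :: "nat \<Rightarrow> real \<Rightarrow> coloring \<Rightarrow> bool" where
  "balanced n \<alpha> c \<longleftrightarrow> (\<forall>x. real (card {i. i < n \<and> c i = x}) \<le> \<alpha> * real n / 2)"

text \<open>
  Walking along the cycle from node \<open>0\<close>, which gets colour \<open>b\<close>, the colour flips at
  every edge of \<open>C\<close>. The two values of \<open>b\<close> give the two colourings, equal up to
  swapping the colours, induced by an even-size set \<open>C\<close> of edges.
\<close>

definition induced_coloring :: "bool \<Rightarrow> nat set \<Rightarrow> coloring" where
  "induced_coloring b C i = (b \<longleftrightarrow> even (card {j \<in> C. j < i}))"

definition valid_cut_set :: "nat \<Rightarrow> nat set \<Rightarrow> bool" where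
  "valid_cut_set n C \<longleftrightarrow> C \<subseteq> {..<n} \<and> even (card C)"

lemma card_less_Suc:
  assumes "finite C"
  shows "card {j \<in> C. j < Suc i} = card {j \<in> C. j < i} + (if i \<in> C then 1 else 0)"
proof (cases "i \<in> C")
  case True
  then have "{j \<in> C. j < Suc i} = insert i {j \<in> C. j < i}"
    by auto
  then show ?thesis using True assms by simp
next
  case False
  then have "{j \<in> C. j < Suc i} = {j \<in> C. j < i}"
    using less_Suc_eq by auto
  then show ?thesis using False by simp
qed

lemma cut_edges_induced_coloring:
  assumes "valid_cut_set n C"
  shows "cut_edges n (induced_coloring b C) = C"
proof -
  have sub: "C \<subseteq> {..<n}" and ev: "even (card C)"
    using assms by (auto simp: valid_cut_set_def)
  have fin: "finite C"
    using sub finite_subset by blast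
  have "induced_coloring b C i \<noteq> induced_coloring b C (Suc i mod n) \<longleftrightarrow> i \<in> C"
    if i: "i < n" for i
  proof (cases "Suc i < n")
    case True
    then show ?thesis by (auto simp: induced_coloring_def card_less_Suc[OF fin])
  next
    case False
    then have n: "n = Suc i" using i by simp
    then have "{j \<in> C. j < Suc i} = C" using sub by auto
    then have "even (card {j \<in> C. j < Suc i})" using ev by simp
    then show ?thesis using n
      by (auto simp: induced_coloring_def card_less_Suc[OF fin] split: if_splits)
  qed
  then show ?thesis using sub by (auto simp: cut_edges_def)
qed

lemma balanced_induced_coloring_swap:
  "balanced n \<alpha> (induced_coloring b C) \<longleftrightarrow> balanced n \<alpha> (induced_coloring (\<not> b) C)"
proof -
  have eq: "{i. i < n \<and> induced_coloring (\<not> b) C i = x} = {i. i < n \<and> induced_coloring b C i = (\<not> x)}" for x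
    by (auto simp: induced_coloring_def)
  have "(\<forall>x. P (\<not> x)) \<longleftrightarrow> (\<forall>x. P x)" for P :: "bool \<Rightarrow> bool"
    by (simp only: all_bool_eq) auto
  from this[of "\<lambda>x. real (card {i. i < n \<and> induced_coloring b C i = x}) \<le> \<alpha> * real n / 2"]
  show ?thesis
    unfolding balanced_def eq by (rule sym)
qed

text \<open>By the preceding lemma, the choice of \<open>True\<close> below is immaterial.\<close>

definition induces_balanced :: "nat \<Rightarrow> real \<Rightarrow> nat set \<Rightarrow> bool" where
  "induces_balanced n \<alpha> C \<longleftrightarrow> valid_cut_set n C \<and> balanced n \<alpha> (induced_coloring True C)"

text \<open>
  The global rebalancing procedure enters only through its specification: \<open>G\<close> is any
  function computing, from a cut set inducing a \<open>1\<close>-balanced colouring, a subset with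
  the required properties.
\<close>

definition global_rebalancing :: "nat \<Rightarrow> nat \<Rightarrow> (nat set \<Rightarrow> nat set) \<Rightarrow> bool" where
  "global_rebalancing n k G \<longleftrightarrow>
     (\<forall>C. induces_balanced n 1 C \<longrightarrow>
        G C \<subseteq> C \<and> card (G C) = min (2 * k) (card C) \<and>
        induces_balanced n (1 + 1 / real k) (G C))"

definition hit_cost :: "nat \<Rightarrow> coloring \<Rightarrow> nat \<Rightarrow> nat" where
  "hit_cost n c e = (if e \<in> cut_edges n c then 1 else 0)"

definition recolor_cost :: "nat \<Rightarrow> coloring \<Rightarrow> coloring \<Rightarrow> nat" where
  "recolor_cost n c d = card {i. i < n \<and> c i \<noteq> d i}"

text \<open>
  A schedule \<open>s\<close> gives the colouring \<open>s t\<close> held after the first \<open>t\<close> requests, so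
  \<open>s 0\<close> is the colouring held when the first request arrives. Replacing the initial
  colouring \<open>c0\<close> by \<open>s 0\<close> is charged as well. An offline algorithm maps
  the whole request sequence to a schedule.
\<close>

type_synonym schedule = "nat \<Rightarrow> coloring"
type_synonym offline_alg = "nat list \<Rightarrow> schedule"

definition total_cost :: "nat \<Rightarrow> coloring \<Rightarrow> schedule \<Rightarrow> nat list \<Rightarrow> nat" where
  "total_cost n c0 s \<sigma> = recolor_cost n c0 (s 0) +
     (\<Sum>t<length \<sigma>. hit_cost n (s t) (\<sigma> ! t) + recolor_cost n (s t) (s (Suc t)))"

definition request_seqs :: "nat \<Rightarrow> nat list set" where
  "request_seqs n = {\<sigma>. set \<sigma> \<subseteq> {..<n}}"

definition OPT :: "nat \<Rightarrow> coloring \<Rightarrow> nat list \<Rightarrow> nat" where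
  "OPT n c0 \<sigma> =
     Inf {total_cost n c0 s \<sigma> | s. s 0 = c0 \<and> (\<forall>t\<le>length \<sigma>. balanced n 1 (s t))}"

text \<open>
  The class of algorithms depends on the initial colouring \<open>c0\<close>, on the
  rebalancing procedure \<open>G\<close>, and on the colour \<open>b\<close> of node \<open>0\<close> that
  selects one of the two colourings induced by \<open>G (cut_edges n c0)\<close>.
\<close>

definition alg_class ::
  "nat \<Rightarrow> nat \<Rightarrow> real \<Rightarrow> (nat set \<Rightarrow> nat set) \<Rightarrow> bool \<Rightarrow> coloring \<Rightarrow> offline_alg set" where
  "alg_class n k \<alpha> G b c0 =
     {A. \<forall>\<sigma>\<in>request_seqs n.
           A \<sigma> 0 = induced_coloring b (G (cut_edges n c0)) \<and>
           (\<forall>t\<le>length \<sigma>. balanced n \<alpha> (A \<sigma> t) \<and> card (cut_edges n (A \<sigma> t)) \<le> 2 * k)}"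

end

theory Submission imports Defs begin

text \<open>
  Time is cut into phases in which the optimum recolours at most \<open>n / (6 * k)\<close> nodes; a
  restart costs \<open>O(n)\<close> and is paid for by the optimum's movement with a factor \<open>O(k)\<close>.
  Call a node static if the optimum does not recolour it during the phase. Between two
  consecutive static nodes of different colours the optimum has a cut edge at all times.
  Two such gaps are chosen so that the arc between them contains between \<open>n / 4\<close> and
  \<open>3 * n / 4 + n / (6 * k)\<close> nodes, and the offline algorithm keeps a single cut in each of
  them, always at a cut edge of the optimum. Hence it is hit only when the optimum is hit.
\<close>

section \<open>Moving a cut inside a gap, with a Hamming-distance potential\<close>

lemma sum_lessThan_add:
  fixes f :: "nat \<Rightarrow> nat"
  shows "(\<Sum>t<a + b. f t) = (\<Sum>t<a. f t) + (\<Sum>t<b. f (a + t))"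
  by (induction b) auto

text \<open>
  The Hamming distance in the gap between \<open>c\<close> and the threshold colouring that switches
  colour after node \<open>x\<close> is the potential that pays for moving the threshold to a cut
  edge: every node passed changes from disagreement to agreement.
\<close>

lemma gap_step:
  fixes c :: coloring
  assumes "a \<le> x" "x < b" "c a = l" "c b \<noteq> l"
  obtains y where "a \<le> y" "y < b" "c y \<noteq> c (Suc y)"
    "(if x \<le> y then y - x else x - y) + card {i. a < i \<and> i < b \<and> (i \<le> y) \<noteq> (c i = l)}
       \<le> card {i. a < i \<and> i < b \<and> (i \<le> x) \<noteq> (c i = l)}"
proof (cases "c x = l")
  \<comment> \<open>The threshold moves right, to just before the first node after \<open>x\<close>
    whose colour is not \<open>l\<close>. Every node passed has colour \<open>l\<close> and stood on
    the wrong side.\<close>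
  case True
  define z where "z = (LEAST z. x < z \<and> c z \<noteq> l)"
  have z: "x < z" "c z \<noteq> l" and le: "z \<le> b"
    using LeastI[of "\<lambda>z. x < z \<and> c z \<noteq> l" b] Least_le[of "\<lambda>z. x < z \<and> c z \<noteq> l" b] assms
    unfolding z_def by auto
  have between: "c i = l" if "x \<le> i" "i < z" for i
    using not_less_Least[of i "\<lambda>z. x < z \<and> c z \<noteq> l"] that True
    unfolding z_def by (cases "i = x") auto
  obtain y where y: "z = Suc y" using z(1) by (cases z) auto
  let ?D = "\<lambda>x. {i. a < i \<and> i < b \<and> (i \<le> x) \<noteq> (c i = l)}"
  have "{x<..y} \<union> ?D y \<subseteq> ?D x"
  proof
    fix i assume "i \<in> {x<..y} \<union> ?D y"
    then show "i \<in> ?D x"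
      using between[of i] y z le assms by (cases "x \<le> i") auto
  qed
  then have "card ({x<..y} \<union> ?D y) \<le> card (?D x)"
    by (intro card_mono) auto
  moreover have "card ({x<..y} \<union> ?D y) = card {x<..y} + card (?D y)"
    using between y by (intro card_Un_disjoint) auto
  ultimately have "card {x<..y} + card (?D y) \<le> card (?D x)"
    by simp
  then show thesis
    using that[of y] between[of y] y z le assms by auto
next
  \<comment> \<open>The threshold moves left, to the last node of colour \<open>l\<close>. The nodes
    passed have the other colour, so they too stop disagreeing.\<close>
  case False
  define y where "y = (GREATEST z. z \<le> x \<and> c z = l)"
  have y: "y \<le> x" "c y = l" and le: "a \<le> y"
    using GreatestI_nat[of "\<lambda>z. z \<le> x \<and> c z = l" a x] Greatest_le_nat[of "\<lambda>z. z \<le> x \<and> c z = l" a x] assms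
    unfolding y_def by auto
  have between: "c i \<noteq> l" if "y < i" "i \<le> x" for i
    using Greatest_le_nat[of "\<lambda>z. z \<le> x \<and> c z = l" i x] that
    unfolding y_def by auto
  let ?D = "\<lambda>x. {i. a < i \<and> i < b \<and> (i \<le> x) \<noteq> (c i = l)}"
  have "{y<..x} \<union> ?D y \<subseteq> ?D x"
    using between y le assms by auto
  then have "card ({y<..x} \<union> ?D y) \<le> card (?D x)"
    by (intro card_mono) auto
  moreover have "card ({y<..x} \<union> ?D y) = card {y<..x} + card (?D y)"
    using between by (intro card_Un_disjoint) auto
  ultimately have "card {y<..x} + card (?D y) \<le> card (?D x)"
    by simp
  moreover have "y < x" using y False by (cases "y = x") auto
  ultimately show thesis
    using that[of y] between[of "Suc y"] y le assms by auto
qed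

text \<open>Iterating \<open>gap_step\<close> telescopes the potential. The movement of the cut is
  thus paid by the initial potential, below the gap length, and by the recolourings that raise the
  potential later.\<close>

lemma gap_track:
  fixes o' :: "nat \<Rightarrow> coloring"
  assumes "a < b" "\<And>t. t \<le> T \<Longrightarrow> o' t a = l" "\<And>t. t \<le> T \<Longrightarrow> o' t b \<noteq> l"
  shows "\<exists>x. (\<forall>t\<le>T. a \<le> x t \<and> x t < b \<and> o' t (x t) \<noteq> o' t (Suc (x t))) \<and>
     (\<Sum>t<T. if x t \<le> x (Suc t) then x (Suc t) - x t else x t - x (Suc t)) +
       card {i. a < i \<and> i < b \<and> (i \<le> x T) \<noteq> (o' T i = l)}
     \<le> b - a + (\<Sum>t<T. card {i. a < i \<and> i < b \<and> o' t i \<noteq> o' (Suc t) i})"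
  using assms(2,3)
proof (induction T)
  case 0
  \<comment> \<open>The initial cut may sit at any cut edge of the gap: reaching it from
    \<open>a\<close> is not charged.\<close>
  obtain y where y: "a \<le> y" "y < b" "o' 0 y \<noteq> o' 0 (Suc y)"
    using gap_step[of a a b "o' 0" l] 0 assms(1) by auto
  have "card {i. a < i \<and> i < b \<and> (i \<le> y) \<noteq> (o' 0 i = l)} \<le> card {a<..<b}"
    by (rule card_mono) auto
  then show ?case
    using y by (intro exI[of _ "\<lambda>_. y"]) auto
next
  case (Suc T)
  let ?D = "\<lambda>x t. {i. a < i \<and> i < b \<and> (i \<le> x) \<noteq> (o' t i = l)}"
  let ?R = "\<lambda>t. {i. a < i \<and> i < b \<and> o' t i \<noteq> o' (Suc t) i}"
  let ?d = "\<lambda>x y :: nat. if x \<le> y then y - x else x - y"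
  obtain x where x: "\<And>t. t \<le> T \<Longrightarrow> a \<le> x t \<and> x t < b \<and> o' t (x t) \<noteq> o' t (Suc (x t))"
    and cost: "(\<Sum>t<T. ?d (x t) (x (Suc t))) + card (?D (x T) T) \<le> b - a + (\<Sum>t<T. card (?R t))"
    using Suc by force
  obtain y where y: "a \<le> y" "y < b" "o' (Suc T) y \<noteq> o' (Suc T) (Suc y)"
    and step: "?d (x T) y + card (?D y (Suc T)) \<le> card (?D (x T) (Suc T))"
    using gap_step[of a "x T" b "o' (Suc T)" l] x[of T] Suc.prems[of "Suc T"] by blast
  \<comment> \<open>With the threshold still in place, one step of \<open>o'\<close> raises the
    potential by at most the number of gap nodes it recolours.\<close>
  have "card (?D (x T) (Suc T)) \<le> card (?D (x T) T \<union> ?R T)"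
    by (rule card_mono) auto
  also have "\<dots> \<le> card (?D (x T) T) + card (?R T)"
    by (rule card_Un_le)
  finally have hamming: "card (?D (x T) (Suc T)) \<le> card (?D (x T) T) + card (?R T)" .
  define x' where "x' = x(Suc T := y)"
  have "(\<Sum>t<T. ?d (x' t) (x' (Suc t))) = (\<Sum>t<T. ?d (x t) (x (Suc t)))"
    by (rule sum.cong) (auto simp: x'_def)
  then have "(\<Sum>t<Suc T. ?d (x' t) (x' (Suc t))) = (\<Sum>t<T. ?d (x t) (x (Suc t))) + ?d (x T) y"
    by (simp add: x'_def)
  moreover have "x' (Suc T) = y" by (simp add: x'_def)
  ultimately have "(\<Sum>t<Suc T. ?d (x' t) (x' (Suc t))) + card (?D (x' (Suc T)) (Suc T))
      \<le> b - a + (\<Sum>t<Suc T. card (?R t))"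
    using cost step hamming by simp
  moreover have "\<forall>t\<le>Suc T. a \<le> x' t \<and> x' t < b \<and> o' t (x' t) \<noteq> o' t (Suc (x' t))"
    using x y by (auto simp: x'_def le_Suc_eq)
  ultimately show ?case by blast
qed

section \<open>Consecutive marked positions of different colours\<close>

text \<open>Take \<open>b\<close> as the earliest marked position that disagrees with a marked one
  in \<open>{l..<b}\<close>, and \<open>a\<close> as the last marked position before
  \<open>b\<close>. Minimality of \<open>b\<close> makes all marked positions of
  \<open>{l..<b}\<close> agree; when marks are static nodes, this bounds how late the change
  occurs.\<close>

lemma adjacent_change:
  fixes c :: coloring
  assumes "l \<le> i" "i < j" "P i" "P j" "c i \<noteq> c j"
  obtains a b where "l \<le> a" "a < b" "b \<le> j" "P a" "P b" "c a \<noteq> c b"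
    "\<And>h. a < h \<Longrightarrow> h < b \<Longrightarrow> \<not> P h"
    "\<And>h. l \<le> h \<Longrightarrow> h < b \<Longrightarrow> P h \<Longrightarrow> c h = c a"
proof -
  let ?Q = "\<lambda>j. P j \<and> (\<exists>i. l \<le> i \<and> i < j \<and> P i \<and> c i \<noteq> c j)"
  define b where "b = (LEAST j. ?Q j)"
  have b: "?Q b" "b \<le> j"
    using LeastI[of ?Q j] Least_le[of ?Q j] assms unfolding b_def by blast+
  have min: "\<not> ?Q h" if "h < b" for h
    using not_less_Least that unfolding b_def by blast
  obtain i' where i': "l \<le> i'" "i' < b" "P i'" "c i' \<noteq> c b" using b by blast
  define a where "a = (GREATEST h. h < b \<and> P h)"
  have a: "a < b" "P a" "i' \<le> a"
    using GreatestI_nat[of "\<lambda>h. h < b \<and> P h" i' b] Greatest_le_nat[of "\<lambda>h. h < b \<and> P h" i' b] i'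
    unfolding a_def by auto
  have gap: "\<not> P h" if "a < h" "h < b" for h
    using Greatest_le_nat[of "\<lambda>h. h < b \<and> P h" h b] that unfolding a_def by auto
  have mono: "c h = c a" if "l \<le> h" "h < b" "P h" for h
    using min[of h] min[of a] a i' that by (metis le_trans linorder_neqE_nat)
  show thesis
    using that[of a b] a b i' gap mono by (metis le_trans)
qed

section \<open>Colourings with a single red arc\<close>

lemma card_interval_coloring:
  assumes "x \<le> y" "y < n"
  shows "card {i. i < n \<and> (x < i \<and> i \<le> y) = v} = (if v then y - x else n - (y - x))"
proof (cases v)
  case True
  then have "{i. i < n \<and> (x < i \<and> i \<le> y) = v} = {x<..y}" using assms by auto
  then show ?thesis using True by simp
next
  case False
  then have "{i. i < n \<and> (x < i \<and> i \<le> y) = v} = {..<n} - {x<..y}" using assms by auto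
  moreover have "card ({..<n} - {x<..y}) = n - (y - x)"
    using assms by (subst card_Diff_subset) auto
  ultimately show ?thesis using False by simp
qed

lemma cut_edges_interval_coloring:
  assumes "x < y" "y < n"
  shows "cut_edges n (\<lambda>i. x < i \<and> i \<le> y) = {x, y}"
proof -
  have "(x < i \<and> i \<le> y) \<noteq> (x < Suc i mod n \<and> Suc i mod n \<le> y) \<longleftrightarrow> i = x \<or> i = y" if "i < n" for i
    using assms that by (cases "Suc i = n") auto
  then show ?thesis using assms unfolding cut_edges_def by auto
qed

lemma recolor_cost_interval_coloring:
  "recolor_cost n (\<lambda>i. x < i \<and> i \<le> y) (\<lambda>i. x' < i \<and> i \<le> y') \<le>
     (if x \<le> x' then x' - x else x - x') + (if y \<le> y' then y' - y else y - y')"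
proof -
  have "recolor_cost n (\<lambda>i. x < i \<and> i \<le> y) (\<lambda>i. x' < i \<and> i \<le> y')
      \<le> card (({x<..x'} \<union> {x'<..x}) \<union> ({y<..y'} \<union> {y'<..y}))"
    unfolding recolor_cost_def by (rule card_mono) auto
  also have "\<dots> \<le> (card {x<..x'} + card {x'<..x}) + (card {y<..y'} + card {y'<..y})"
    by (meson add_mono card_Un_le le_trans)
  finally show ?thesis by auto
qed

section \<open>Recolouring bounds and a single phase\<close>

lemma recolor_cost_le: "recolor_cost n c d \<le> n"
proof -
  have "recolor_cost n c d \<le> card {..<n}"
    unfolding recolor_cost_def by (intro card_mono) auto
  then show ?thesis by simp
qed

text \<open>A node that ever leaves its initial colour is recoloured in some step, so a union bound
  over the steps suffices. It limits the number of nodes that are not static.\<close>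

lemma card_recolored_le:
  "card {i. i < n \<and> (\<exists>t\<le>T. p t i \<noteq> p 0 i)} \<le> (\<Sum>t<T. recolor_cost n (p t) (p (Suc t)))"
proof -
  let ?R = "\<Union>t<T. {i. i < n \<and> p t i \<noteq> p (Suc t) i}"
  have "{i. i < n \<and> (\<exists>t\<le>T. p t i \<noteq> p 0 i)} \<subseteq> ?R"
  proof
    fix i assume i: "i \<in> {i. i < n \<and> (\<exists>t\<le>T. p t i \<noteq> p 0 i)}"
    have "p t i = p 0 i" if "t \<le> T" "\<forall>t<T. p t i = p (Suc t) i" for t
      using that by (induction t) auto
    then show "i \<in> ?R" using i by blast
  qed
  then have "card {i. i < n \<and> (\<exists>t\<le>T. p t i \<noteq> p 0 i)} \<le> card ?R"
    by (intro card_mono) auto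
  also have "\<dots> \<le> (\<Sum>t<T. recolor_cost n (p t) (p (Suc t)))"
    unfolding recolor_cost_def by (rule card_UN_le) auto
  finally show ?thesis .
qed

text \<open>The first gap is placed at \<open>0\<close> and \<open>g\<close>; the second is the
  first colour change among static nodes from a position \<open>L\<close> on. Starting at
  \<open>L\<close> keeps the arc long enough. It does not get too long, because the static nodes
  passed since \<open>L\<close> share one colour and a colour class has at most half of the
  nodes.\<close>

lemma phase_at_zero:
  fixes p :: schedule and n k T g :: nat
  defines "M \<equiv> \<Sum>t<T. recolor_cost n (p t) (p (Suc t))"
  assumes bal: "balanced n 1 (p 0)" and k: "1 \<le> k" and small: "6 * k * M \<le> n" and g: "0 < g" "g < n"
    and static: "\<And>t. t \<le> T \<Longrightarrow> p t 0 = p 0 0" "\<And>t. t \<le> T \<Longrightarrow> p t g = p 0 g" "p 0 0 \<noteq> p 0 g"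
    and gap: "\<And>i. 0 < i \<Longrightarrow> i < g \<Longrightarrow> \<exists>t\<le>T. p t i \<noteq> p 0 i"
  shows "\<exists>s. (\<forall>t\<le>T. cut_edges n (s t) \<subseteq> cut_edges n (p t) \<and> card (cut_edges n (s t)) \<le> 2 * k \<and>
                 balanced n (3 / 2 + 1 / real k) (s t)) \<and>
             (\<Sum>t<T. recolor_cost n (s t) (s (Suc t))) \<le> 2 * n + 2 * M"
proof -
  \<comment> \<open>The periodic extension lets index \<open>n\<close> stand for node
    \<open>0\<close>, so that the second gap may end there.\<close>
  define c where "c t j = p t (j mod n)" for t j
  define P where "P j \<longleftrightarrow> (\<forall>t\<le>T. c t j = c 0 j)" for j
  define U where "U = {i. i < n \<and> \<not> P i}"
  have c_less: "c t i = p t i" if "i < n" for t i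
    using that by (simp add: c_def)
  have c_n: "c t n = p t 0" for t by (simp add: c_def)

  have "U = {i. i < n \<and> (\<exists>t\<le>T. p t i \<noteq> p 0 i)}"
    using c_less by (auto simp: U_def P_def)
  then have card_U: "card U \<le> M"
    unfolding M_def using card_recolored_le by simp
  have "6 * M \<le> 6 * k * M" using k by simp
  then have M: "6 * M \<le> n" using small by linarith

  have half: "2 * card {i. i < n \<and> p 0 i = v} \<le> n" for v
  proof -
    have "real (card {i. i < n \<and> p 0 i = v}) \<le> real n / 2"
      using bal unfolding balanced_def by simp
    then show ?thesis by linarith
  qed
  \<comment> \<open>The source of both length bounds: one initial colour accounts for at most
    \<open>n / 2\<close> nodes, the nodes in \<open>U\<close> for at most \<open>M\<close>
    more.\<close>
  have count: "2 * card A \<le> n + 2 * M" if "A \<subseteq> {i. i < n \<and> p 0 i = v} \<union> U" for A v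
  proof -
    have "card A \<le> card ({i. i < n \<and> p 0 i = v} \<union> U)"
      using that by (intro card_mono) (auto simp: U_def)
    also have "\<dots> \<le> card {i. i < n \<and> p 0 i = v} + card U"
      by (rule card_Un_le)
    finally show ?thesis using half[of v] card_U by linarith
  qed
  have gap_U: "{1..<g} \<subseteq> U"
    using gap g c_less by (auto simp: U_def P_def Suc_le_eq)
  then have "card {1..<g} \<le> card U" by (intro card_mono) (auto simp: U_def)
  then have g_M: "g - 1 \<le> M" using card_U by simp

  \<comment> \<open>\<open>q\<close> is the ceiling of \<open>n / 4\<close>. The static nodes of \<open>{L..<b}\<close> below have one
    colour, so there are at most \<open>n / 2\<close> of them.\<close>
  define q where "q = (n + 3) div 4"
  \<comment> \<open>The first cut is at most \<open>g - 1\<close>, so a second cut at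
    \<open>L\<close> or later leaves at least \<open>q\<close> nodes on the arc.\<close>
  define L where "L = g - 1 + q"
  have q: "n \<le> 4 * q" "4 * q \<le> n + 3" unfolding q_def by linarith+
  have gL: "g \<le> L" using q(1) g unfolding L_def by linarith
  have "2 \<le> n" using g by simp
  moreover have "6 * (g - 1) \<le> n" using g_M M by linarith
  ultimately have "2 \<le> real n" "6 * real (g - 1) \<le> real n" "4 * real q \<le> real n + 3"
    using q(2) by linarith+
  then have "real (g - 1) + real q \<le> real n" by linarith
  then have Ln: "L \<le> n" unfolding L_def by linarith
  have Pn: "P n" unfolding P_def c_n using static(1) by blast

  \<comment> \<open>Otherwise node \<open>0\<close>, the first gap and everything from
    \<open>L\<close> on, \<open>n + 1 - q\<close> nodes in all, would be of one colour or in
    \<open>U\<close>. This exceeds \<open>n / 2 + M\<close>, since \<open>M\<close> is at most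
    \<open>n / 6\<close>.\<close>
  have "\<exists>j. L \<le> j \<and> j < n \<and> P j \<and> c 0 j \<noteq> p 0 0"
  proof (rule ccontr)
    assume "\<not> ?thesis"
    then have "{L..<n} \<subseteq> {i. i < n \<and> p 0 i = p 0 0} \<union> U"
      using c_less by (auto simp: U_def)
    then have "insert 0 ({1..<g} \<union> {L..<n}) \<subseteq> {i. i < n \<and> p 0 i = p 0 0} \<union> U"
      using gap_U g by auto
    then have "2 * card (insert 0 ({1..<g} \<union> {L..<n})) \<le> n + 2 * M"
      by (rule count)
    moreover have "card ({1..<g} \<union> {L..<n}) = (g - 1) + (n - L)"
      using gL by (subst card_Un_disjoint) auto
    then have "card (insert 0 ({1..<g} \<union> {L..<n})) = Suc ((g - 1) + (n - L))"
      using gL g by (subst card_insert_disjoint) auto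
    moreover have "Suc ((g - 1) + (n - L)) + q = n + 1" using Ln g unfolding L_def by linarith
    ultimately obtain w where "2 * w \<le> n + 2 * M" "w + q = n + 1" by metis
    then have "n + 2 \<le> 2 * M + 2 * q" by presburger
    then have "real n + 2 \<le> 2 * real M + 2 * real q" by linarith
    moreover have "4 * real q \<le> real n + 3" "6 * real M \<le> real n" using q(2) M by linarith+
    ultimately show False by linarith
  qed
  then obtain j where j: "L \<le> j" "j < n" "P j" "c 0 j \<noteq> c 0 n" by (auto simp: c_n)
  obtain a b where ab: "L \<le> a" "a < b" "b \<le> n" "P a" "P b" "c 0 a \<noteq> c 0 b"
    and mono: "\<And>h. L \<le> h \<Longrightarrow> h < b \<Longrightarrow> P h \<Longrightarrow> c 0 h = c 0 a"
    using adjacent_change[of L j n P "c 0", OF j(1,2,3) Pn j(4)] by metis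
  have "{L..<b} \<subseteq> {i. i < n \<and> p 0 i = c 0 a} \<union> U"
  proof
    fix i assume i: "i \<in> {L..<b}"
    then have "i < n" "L \<le> i" "i < b" using ab by auto
    then show "i \<in> {i. i < n \<and> p 0 i = c 0 a} \<union> U"
      using mono[of i] c_less[of i 0] unfolding U_def by blast
  qed
  \<comment> \<open>Counting the interior of the first gap together with \<open>{L..<b}\<close>
    absorbs the summand \<open>g - 1\<close> of \<open>L\<close>, so the recoloured nodes are
    charged only once.\<close>
  then have "{1..<g} \<union> {L..<b} \<subseteq> {i. i < n \<and> p 0 i = c 0 a} \<union> U"
    using gap_U by blast
  then have "2 * card ({1..<g} \<union> {L..<b}) \<le> n + 2 * M" by (rule count)
  moreover have "card ({1..<g} \<union> {L..<b}) = (g - 1) + (b - L)"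
    using gL by (subst card_Un_disjoint) auto
  moreover have "(g - 1) + (b - L) + q = b" using ab(1,2) unfolding L_def by linarith
  ultimately obtain w where "2 * w \<le> n + 2 * M" "w + q = b" by metis
  then have "2 * b \<le> n + 2 * M + 2 * q" by presburger
  then have b: "4 * b \<le> 3 * n + 4 * M + 3" using q(2) by simp

  let ?d = "\<lambda>x y :: nat. if x \<le> y then y - x else x - y"
  \<comment> \<open>Used for both gaps. For \<open>r = n\<close> the cut may be
    \<open>n - 1\<close>, the edge closing the cycle.\<close>
  have track: "\<exists>x. (\<forall>t\<le>T. l \<le> x t \<and> x t < r \<and> x t \<in> cut_edges n (p t)) \<and>
      (\<Sum>t<T. ?d (x t) (x (Suc t))) \<le> n + M"
    if lr: "l < r" "r \<le> n" "P l" "P r" "c 0 l \<noteq> c 0 r" for l r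
  proof -
    obtain x where x: "\<forall>t\<le>T. l \<le> x t \<and> x t < r \<and> c t (x t) \<noteq> c t (Suc (x t))"
      and cost: "(\<Sum>t<T. ?d (x t) (x (Suc t)))
        \<le> r - l + (\<Sum>t<T. card {i. l < i \<and> i < r \<and> c t i \<noteq> c (Suc t) i})"
    proof -
      have "c t l = c 0 l" "c t r \<noteq> c 0 l" if "t \<le> T" for t
        using lr(3,4,5) that unfolding P_def by metis+
      then show thesis
        using gap_track[where o' = c and T = T and l = "c 0 l", OF lr(1)] that
        by (metis (no_types, lifting) add_leD1)
    qed
    have "card {i. l < i \<and> i < r \<and> c t i \<noteq> c (Suc t) i} \<le> recolor_cost n (p t) (p (Suc t))" for t
      unfolding recolor_cost_def using lr(2) c_less by (intro card_mono) auto
    then have "(\<Sum>t<T. card {i. l < i \<and> i < r \<and> c t i \<noteq> c (Suc t) i}) \<le> M"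
      unfolding M_def by (intro sum_mono)
    then show ?thesis
    proof (intro exI[of _ x] conjI allI impI)
      fix t assume "t \<le> T"
      with x have "l \<le> x t" "x t < r" "c t (x t) \<noteq> c t (Suc (x t))" by blast+
      then show "l \<le> x t" "x t < r" "x t \<in> cut_edges n (p t)"
        using lr(2) by (auto simp: cut_edges_def c_def)
    qed (use cost lr(2) in linarith)
  qed
  have "0 < n" using g by simp
  then have P0: "P 0" "P g" "c 0 0 \<noteq> c 0 g"
    unfolding P_def c_less[OF \<open>0 < n\<close>] c_less[OF g(2)] using static by blast+
  obtain x where x: "\<And>t. t \<le> T \<Longrightarrow> x t < g \<and> x t \<in> cut_edges n (p t)"
    and x_cost: "(\<Sum>t<T. ?d (x t) (x (Suc t))) \<le> n + M"
    using track[OF g(1) less_imp_le[OF g(2)] P0] by blast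
  obtain y where y: "\<And>t. t \<le> T \<Longrightarrow> a \<le> y t \<and> y t < b \<and> y t \<in> cut_edges n (p t)"
    and y_cost: "(\<Sum>t<T. ?d (y t) (y (Suc t))) \<le> n + M"
    using track[OF ab(2,3,4,5,6)] by blast
  define s where "s t = (\<lambda>i. x t < i \<and> i \<le> y t)" for t
  have "cut_edges n (s t) \<subseteq> cut_edges n (p t) \<and> card (cut_edges n (s t)) \<le> 2 * k \<and>
      balanced n (3 / 2 + 1 / real k) (s t)" if t: "t \<le> T" for t
  proof -
    have xy: "x t < g" "L \<le> y t" "y t < b" "x t < y t" "y t < n"
      using x[OF t] y[OF t] ab gL by auto
    have cuts: "cut_edges n (s t) = {x t, y t}"
      unfolding s_def by (rule cut_edges_interval_coloring) fact+
    \<comment> \<open>The red arc has at most \<open>b - 1\<close> nodes, which removes the rounding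
      term \<open>3\<close> from the bound on \<open>b\<close>. The blue rest is at most
      \<open>3 * n / 4\<close> because the arc has at least \<open>q\<close> nodes.\<close>
    have 4: "4 * real (card {i. i < n \<and> s t i = v}) \<le> 3 * real n + 4 * real M" for v
    proof -
      have "card {i. i < n \<and> s t i = v} = (if v then y t - x t else n - (y t - x t))"
        unfolding s_def by (rule card_interval_coloring) (use xy in auto)
      moreover have "y t - x t + 1 \<le> b" using xy by simp
      then have "4 * (y t - x t) \<le> 3 * n + 4 * M" using b by linarith
      moreover have "q \<le> y t - x t" using xy unfolding L_def by linarith
      then have "4 * (n - (y t - x t)) \<le> 3 * n" using q by linarith
      ultimately have "4 * card {i. i < n \<and> s t i = v} \<le> 3 * n + 4 * M" by simp
      from of_nat_mono[OF this, where 'a = real] show ?thesis by simp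
    qed
    \<comment> \<open>The excess \<open>M\<close> over \<open>3 * n / 4\<close> is at most
      \<open>n / (6 * k)\<close>, while the augmentation leaves room for
      \<open>n / (2 * k)\<close>.\<close>
    have "6 * real k * real M \<le> real n"
      using of_nat_mono[OF small, where 'a = real] by simp
    then have "6 * real M \<le> real n / real k" using k by (simp add: field_simps)
    then have "balanced n (3 / 2 + 1 / real k) (s t)"
      unfolding balanced_def
    proof (intro allI)
      fix v
      show "real (card {i. i < n \<and> s t i = v}) \<le> (3 / 2 + 1 / real k) * real n / 2"
        using 4[of v] \<open>6 * real M \<le> real n / real k\<close> by (simp add: algebra_simps add_divide_distrib)
    qed
    then show ?thesis using cuts x[OF t] y[OF t] xy k by auto
  qed
  moreover have "(\<Sum>t<T. recolor_cost n (s t) (s (Suc t))) \<le>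
      (\<Sum>t<T. ?d (x t) (x (Suc t)) + ?d (y t) (y (Suc t)))"
    unfolding s_def by (intro sum_mono recolor_cost_interval_coloring)
  then have "(\<Sum>t<T. recolor_cost n (s t) (s (Suc t))) \<le> 2 * n + 2 * M"
    using x_cost y_cost unfolding sum.distrib by linarith
  ultimately show ?thesis by blast
qed

section \<open>Rotating the cycle\<close>

definition rotate_coloring :: "nat \<Rightarrow> nat \<Rightarrow> coloring \<Rightarrow> coloring" where
  "rotate_coloring n r c i = c ((i + r) mod n)"

lemma rotate_mod_inverse:
  fixes i n r :: nat
  assumes "i < n" "r \<le> n"
  shows "((i + r) mod n + (n - r)) mod n = i"
proof -
  have "((i + r) mod n + (n - r)) mod n = (i + r + (n - r)) mod n"
    by (rule mod_add_left_eq)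
  then show ?thesis using assms by simp
qed

lemma card_rotate:
  fixes n r :: nat
  assumes "r \<le> n"
  shows "card {i. i < n \<and> P ((i + r) mod n)} = card {i. i < n \<and> P i}"
proof (rule bij_betw_same_card)
  have "((i + (n - r)) mod n + r) mod n = i" if "i < n" for i
    using rotate_mod_inverse[OF that, of "n - r"] assms by simp
  then show "bij_betw (\<lambda>i. (i + r) mod n) {i. i < n \<and> P ((i + r) mod n)} {i. i < n \<and> P i}"
    using rotate_mod_inverse[of _ n r] assms
    by (intro bij_betw_byWitness[where f' = "\<lambda>i. (i + (n - r)) mod n"]) auto
qed

lemma balanced_rotate:
  assumes "r \<le> n"
  shows "balanced n \<alpha> (rotate_coloring n r c) \<longleftrightarrow> balanced n \<alpha> c"
  unfolding balanced_def rotate_coloring_def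
  using card_rotate[OF assms, of "\<lambda>i. c i = _"] by simp

lemma recolor_cost_rotate:
  assumes "r \<le> n"
  shows "recolor_cost n (rotate_coloring n r c) (rotate_coloring n r d) = recolor_cost n c d"
  unfolding recolor_cost_def rotate_coloring_def
  using card_rotate[OF assms, of "\<lambda>i. c i \<noteq> d i"] by simp

lemma cut_edges_rotate:
  "cut_edges n (rotate_coloring n r c) = {i. i < n \<and> (i + r) mod n \<in> cut_edges n c}"
  unfolding cut_edges_def rotate_coloring_def
  by (auto simp: mod_Suc_eq mod_add_left_eq)

lemma card_cut_edges_rotate:
  assumes "r \<le> n"
  shows "card (cut_edges n (rotate_coloring n r c)) = card (cut_edges n c)"
proof -
  have "{i. i < n \<and> i \<in> cut_edges n c} = cut_edges n c" by (auto simp: cut_edges_def)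
  then show ?thesis
    unfolding cut_edges_rotate card_rotate[OF assms, of "\<lambda>i. i \<in> cut_edges n c"] by simp
qed

text \<open>Reduces to \<open>phase_at_zero\<close> by rotating the left end of a gap to node
  \<open>0\<close>; balance, numbers of cut edges and recolouring costs are invariant under
  rotation.\<close>

lemma phase:
  fixes p :: schedule and n k T :: nat
  defines "M \<equiv> \<Sum>t<T. recolor_cost n (p t) (p (Suc t))"
  assumes n: "0 < n" and bal: "balanced n 1 (p 0)" and k: "1 \<le> k" and small: "6 * k * M \<le> n"
  shows "\<exists>s. (\<forall>t\<le>T. cut_edges n (s t) \<subseteq> cut_edges n (p t) \<and> card (cut_edges n (s t)) \<le> 2 * k \<and>
                 balanced n (3 / 2 + 1 / real k) (s t)) \<and>
             (\<Sum>t<T. recolor_cost n (s t) (s (Suc t))) \<le> 2 * n + 2 * M"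
proof -
  have half: "real (card {i. i < n \<and> p 0 i = v}) \<le> real n / 2" for v
    using bal unfolding balanced_def by simp
  define P where "P i \<longleftrightarrow> i < n \<and> (\<forall>t\<le>T. p t i = p 0 i)" for i
  have "6 * M \<le> 6 * k * M" using k by simp
  then have M: "6 * M \<le> n" using small by linarith
  \<comment> \<open>The opposite colour and the recoloured nodes cover at most
    \<open>n / 2 + n / 6\<close> nodes, fewer than \<open>n\<close>.\<close>
  have static: "\<exists>i. P i \<and> p 0 i = v" for v
  proof (rule ccontr)
    let ?U = "{i. i < n \<and> (\<exists>t\<le>T. p t i \<noteq> p 0 i)}"
    assume "\<not> ?thesis"
    then have "{..<n} \<subseteq> {i. i < n \<and> p 0 i = (\<not> v)} \<union> ?U"
      by (auto simp: P_def)
    then have "card {..<n} \<le> card ({i. i < n \<and> p 0 i = (\<not> v)} \<union> ?U)"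
      by (intro card_mono) auto
    also have "\<dots> \<le> card {i. i < n \<and> p 0 i = (\<not> v)} + card ?U"
      by (rule card_Un_le)
    finally have "n \<le> card {i. i < n \<and> p 0 i = (\<not> v)} + M"
      using card_recolored_le[of n T p] unfolding M_def by simp
    then show False using half[of "\<not> v"] M n by linarith
  qed
  from static[of True] static[of False] obtain u w where "P u" "p 0 u" "P w" "\<not> p 0 w" by auto
  then have "\<exists>i j. i < j \<and> P i \<and> P j \<and> p 0 i \<noteq> p 0 j"
    by (metis linorder_neqE_nat)
  then obtain i j where ij: "i < j" "P i" "P j" "p 0 i \<noteq> p 0 j" by blast
  obtain r b where rb: "r < b" "P r" "P b" "p 0 r \<noteq> p 0 b"
    and gap: "\<And>h. r < h \<Longrightarrow> h < b \<Longrightarrow> \<not> P h"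
    using adjacent_change[of 0 i j P "p 0", OF le0 ij] by metis
  have fixed: "p t r = p 0 r" "p t b = p 0 b" if "t \<le> T" for t
    using rb(2,3) that unfolding P_def by blast+
  have rn: "r \<le> n" "b < n" using rb(1,2,3) unfolding P_def by (blast intro: less_imp_le)+
  have rot: "rotate_coloring n r (p t) i = p t (r + i)" if "r + i < n" for t i
    using that by (simp add: rotate_coloring_def add.commute)
  have M_rotate: "(\<Sum>t<T. recolor_cost n (rotate_coloring n r (p t)) (rotate_coloring n r (p (Suc t)))) = M"
    unfolding M_def by (simp add: recolor_cost_rotate[OF rn(1)])
  have "\<exists>s. (\<forall>t\<le>T. cut_edges n (s t) \<subseteq> cut_edges n (rotate_coloring n r (p t)) \<and>
        card (cut_edges n (s t)) \<le> 2 * k \<and> balanced n (3 / 2 + 1 / real k) (s t)) \<and>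
      (\<Sum>t<T. recolor_cost n (s t) (s (Suc t))) \<le> 2 * n +
        2 * (\<Sum>t<T. recolor_cost n (rotate_coloring n r (p t)) (rotate_coloring n r (p (Suc t))))"
  proof (rule phase_at_zero[where g = "b - r"])
    show "balanced n 1 (rotate_coloring n r (p 0))" using bal rn by (simp add: balanced_rotate)
    show "6 * k * (\<Sum>t<T. recolor_cost n (rotate_coloring n r (p t)) (rotate_coloring n r (p (Suc t)))) \<le> n"
      using small M_rotate by simp
    show "\<exists>t\<le>T. rotate_coloring n r (p t) i \<noteq> rotate_coloring n r (p 0) i" if "0 < i" "i < b - r" for i
    proof -
      have "r + i < n" "\<not> P (r + i)" using gap[of "r + i"] that rn by auto
      then show ?thesis by (auto simp: P_def rot)
    qed
    show "rotate_coloring n r (p t) 0 = rotate_coloring n r (p 0) 0"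
      "rotate_coloring n r (p t) (b - r) = rotate_coloring n r (p 0) (b - r)" if "t \<le> T" for t
      using fixed[OF that] rb(1) rn by (simp_all only: rot add_0_right le_add_diff_inverse less_imp_le)
    show "rotate_coloring n r (p 0) 0 \<noteq> rotate_coloring n r (p 0) (b - r)"
      using rb(1,4) rn by (simp add: rot)
  qed (use k rb(1) rn in auto)
  then obtain s where s: "\<And>t. t \<le> T \<Longrightarrow> cut_edges n (s t) \<subseteq> cut_edges n (rotate_coloring n r (p t)) \<and>
        card (cut_edges n (s t)) \<le> 2 * k \<and> balanced n (3 / 2 + 1 / real k) (s t)"
    and cost: "(\<Sum>t<T. recolor_cost n (s t) (s (Suc t))) \<le> 2 * n + 2 * M"
    unfolding M_rotate by blast
  define s' where "s' t = rotate_coloring n (n - r) (s t)" for t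
  have "cut_edges n (s' t) \<subseteq> cut_edges n (p t)" if "t \<le> T" for t
  proof
    fix i assume i: "i \<in> cut_edges n (s' t)"
    then have "i < n" and "(i + (n - r)) mod n \<in> cut_edges n (s t)"
      by (auto simp: s'_def cut_edges_rotate)
    then have "((i + (n - r)) mod n + r) mod n \<in> cut_edges n (p t)"
      using s[OF that] by (auto simp: cut_edges_rotate)
    then show "i \<in> cut_edges n (p t)"
      using rotate_mod_inverse[OF \<open>i < n\<close>, of "n - r"] rn by simp
  qed
  then show ?thesis
    using s cost
    by (intro exI[of _ s'])
      (auto simp: s'_def balanced_rotate card_cut_edges_rotate recolor_cost_rotate)
qed

section \<open>Concatenating phases\<close>

lemma phases:
  fixes p :: schedule and n k T :: nat
  assumes n: "0 < n" and k: "1 \<le> k" and bal: "\<And>t. t \<le> T \<Longrightarrow> balanced n 1 (p t)"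
  shows "\<exists>s. (\<forall>t\<le>T. cut_edges n (s t) \<subseteq> cut_edges n (p t) \<and> card (cut_edges n (s t)) \<le> 2 * k \<and>
                 balanced n (3 / 2 + 1 / real k) (s t)) \<and>
             (\<Sum>t<T. recolor_cost n (s t) (s (Suc t)))
               \<le> 2 * n + 20 * k * (\<Sum>t<T. recolor_cost n (p t) (p (Suc t)))"
  using bal
proof (induction T arbitrary: p rule: less_induct)
  case (less T)
  let ?good = "\<lambda>c d. cut_edges n d \<subseteq> cut_edges n c \<and> card (cut_edges n d) \<le> 2 * k \<and>
    balanced n (3 / 2 + 1 / real k) d"
  define M where "M T = (\<Sum>t<T. recolor_cost n (p t) (p (Suc t)))" for T
  have k_mult: "2 * m \<le> 20 * k * m" for m using k by simp
  show ?case
  proof (cases "6 * k * M T \<le> n")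
    case True
    obtain s where "\<forall>t\<le>T. ?good (p t) (s t)"
      and "(\<Sum>t<T. recolor_cost n (s t) (s (Suc t))) \<le> 2 * n + 2 * M T"
      using phase[of n p k T] n k less.prems[of 0] True unfolding M_def by auto
    moreover from this(2) have "(\<Sum>t<T. recolor_cost n (s t) (s (Suc t))) \<le> 2 * n + 20 * k * M T"
      using k_mult[of "M T"] by linarith
    ultimately show ?thesis unfolding M_def by blast
  next
    case False
    \<comment> \<open>The first phase extends as far as \<open>phase\<close> allows, up to time
      \<open>v = u - 1\<close>. The step to \<open>u\<close> is a restart costing at most
      \<open>n\<close>, and induction handles the times from \<open>u\<close> on.\<close>
    define u where "u = (LEAST u. \<not> 6 * k * M u \<le> n)"
    have u: "\<not> 6 * k * M u \<le> n" "u \<le> T"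
      using LeastI[of "\<lambda>u. \<not> 6 * k * M u \<le> n" T] Least_le[of "\<lambda>u. \<not> 6 * k * M u \<le> n" T] False
      unfolding u_def by auto
    then have "u \<noteq> 0" unfolding M_def by (intro notI) auto
    then obtain v where v: "u = Suc v" by (cases u) auto
    then have small: "6 * k * M v \<le> n"
      using not_less_Least[of v "\<lambda>u. \<not> 6 * k * M u \<le> n"] unfolding u_def by auto
    obtain s1 where s1: "\<forall>t\<le>v. ?good (p t) (s1 t)"
      and cost1: "(\<Sum>t<v. recolor_cost n (s1 t) (s1 (Suc t))) \<le> 2 * n + 2 * M v"
      using phase[of n p k v] n k less.prems[of 0] small unfolding M_def by auto
    obtain s2 where s2: "\<forall>t\<le>T - u. ?good (p (u + t)) (s2 t)"
      and cost2: "(\<Sum>t<T - u. recolor_cost n (s2 t) (s2 (Suc t)))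
        \<le> 2 * n + 20 * k * (\<Sum>t<T - u. recolor_cost n (p (u + t)) (p (u + Suc t)))"
      using less.IH[of "T - u" "\<lambda>t. p (u + t)"] less.prems u v by auto
    define s where "s t = (if t \<le> v then s1 t else s2 (t - u))" for t
    have split: "(\<Sum>t<T. f t) = (\<Sum>t<v. f t) + f v + (\<Sum>t<T - u. f (u + t))" for f :: "nat \<Rightarrow> nat"
      using sum_lessThan_add[of f u "T - u"] u v by simp
    have "(\<Sum>t<v. recolor_cost n (s t) (s (Suc t))) = (\<Sum>t<v. recolor_cost n (s1 t) (s1 (Suc t)))"
      by (rule sum.cong) (auto simp: s_def)
    moreover have "(\<Sum>t<T - u. recolor_cost n (s (u + t)) (s (Suc (u + t)))) =
        (\<Sum>t<T - u. recolor_cost n (s2 t) (s2 (Suc t)))"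
      by (rule sum.cong) (auto simp: s_def v Suc_diff_le)
    moreover have "recolor_cost n (s v) (s (Suc v)) \<le> n"
      by (rule recolor_cost_le)
    ultimately have "(\<Sum>t<T. recolor_cost n (s t) (s (Suc t)))
        \<le> (2 * n + 2 * M v) + n + (2 * n + 20 * k * (\<Sum>t<T - u. recolor_cost n (p (u + t)) (p (Suc (u + t)))))"
      using cost1 cost2 unfolding split[of "\<lambda>t. recolor_cost n (s t) (s (Suc t))"] by simp
    \<comment> \<open>Origin of \<open>20\<close>: by choice of \<open>u\<close>,
      \<open>18 * k * M u\<close> exceeds \<open>3 * n\<close>, the cost of the phase start and the
      restart; another \<open>2 * k * M u\<close> covers \<open>2 * M v\<close>.\<close>
    also have "\<dots> \<le> 2 * n + 20 * k * (M u + (\<Sum>t<T - u. recolor_cost n (p (u + t)) (p (Suc (u + t)))))"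
    proof -
      have "M v \<le> M u" unfolding M_def v by simp
      then have "2 * M v \<le> 2 * (k * M u)" using k by (metis mult_le_mono le_refl mult_1)
      then show ?thesis using u(1) by (simp add: algebra_simps)
    qed
    also have "M u + (\<Sum>t<T - u. recolor_cost n (p (u + t)) (p (Suc (u + t)))) = M T"
      using sum_lessThan_add[of "\<lambda>t. recolor_cost n (p t) (p (Suc t))" u "T - u"] u unfolding M_def by simp
    finally have "(\<Sum>t<T. recolor_cost n (s t) (s (Suc t))) \<le> 2 * n + 20 * k * M T" .
    moreover have "?good (p t) (s t)" if "t \<le> T" for t
    proof (cases "t \<le> v")
      case True
      then show ?thesis using s1 by (simp add: s_def)
    next
      case False
      then show ?thesis using s2[rule_format, of "t - u"] that v by (simp add: s_def)
    qed
    ultimately show ?thesis unfolding M_def by blast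
  qed
qed

section \<open>Comparison with the optimum\<close>

lemma OPT_attained:
  assumes "balanced n 1 c0"
  obtains p where "p 0 = c0" "\<And>t. t \<le> length \<sigma> \<Longrightarrow> balanced n 1 (p t)"
    "OPT n c0 \<sigma> = total_cost n c0 p \<sigma>"
proof -
  let ?K = "{total_cost n c0 s \<sigma> | s. s 0 = c0 \<and> (\<forall>t\<le>length \<sigma>. balanced n 1 (s t))}"
  have "total_cost n c0 (\<lambda>_. c0) \<sigma> \<in> ?K" using assms by auto
  then have "?K \<noteq> {}" by blast
  then have "OPT n c0 \<sigma> \<in> ?K" unfolding OPT_def by (rule Inf_nat_def1)
  then show thesis using that by auto
qed

text \<open>\<open>phases\<close> is applied to an optimal schedule. The additive
  \<open>4 * n\<close> consists of \<open>2 * n\<close> from there, \<open>n\<close> for replacing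
  \<open>c0\<close> by \<open>d\<close>, and \<open>n\<close> for leaving \<open>d\<close> at the
  first request.\<close>

lemma offline_schedule:
  assumes n: "0 < n" and k: "1 \<le> k" and bal: "balanced n 1 c0"
    and d: "cut_edges n d \<subseteq> cut_edges n c0" "card (cut_edges n d) \<le> 2 * k"
      "balanced n (3 / 2 + 1 / real k) d"
  shows "\<exists>s. s 0 = d \<and>
    (\<forall>t\<le>length \<sigma>. balanced n (3 / 2 + 1 / real k) (s t) \<and> card (cut_edges n (s t)) \<le> 2 * k) \<and>
    total_cost n c0 s \<sigma> \<le> 20 * k * OPT n c0 \<sigma> + 4 * n"
proof -
  obtain p where p: "p 0 = c0" "\<And>t. t \<le> length \<sigma> \<Longrightarrow> balanced n 1 (p t)"
    and opt: "OPT n c0 \<sigma> = total_cost n c0 p \<sigma>"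
    using OPT_attained[OF bal, of \<sigma>] by blast
  let ?T = "length \<sigma>"
  let ?M = "\<lambda>s. \<Sum>t<?T. recolor_cost n (s t) (s (Suc t))"
  let ?H = "\<lambda>s. \<Sum>t<?T. hit_cost n (s t) (\<sigma> ! t)"
  obtain s where s: "\<And>t. t \<le> ?T \<Longrightarrow> cut_edges n (s t) \<subseteq> cut_edges n (p t) \<and>
      card (cut_edges n (s t)) \<le> 2 * k \<and> balanced n (3 / 2 + 1 / real k) (s t)"
    and cost: "?M s \<le> 2 * n + 20 * k * ?M p"
    using phases[of n k ?T p] n k p(2) by auto
  \<comment> \<open>Overwriting only time \<open>0\<close> is harmless for hits: the cut edges of
    \<open>d\<close> lie among those of \<open>c0\<close>, which the optimum holds at that
    time.\<close>
  define s' where "s' = s(0 := d)"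
  have "?M s' \<le> n + ?M s"
  proof (cases ?T)
    case (Suc m)
    have "(\<Sum>t<m. recolor_cost n (s' (Suc t)) (s' (Suc (Suc t)))) =
        (\<Sum>t<m. recolor_cost n (s (Suc t)) (s (Suc (Suc t))))"
      by (simp add: s'_def)
    then show ?thesis
      using recolor_cost_le[of n "s' 0" "s' (Suc 0)"] unfolding Suc sum.lessThan_Suc_shift by simp
  qed simp
  moreover have "?H s' \<le> ?H p"
  proof (rule sum_mono)
    fix t assume "t \<in> {..<?T}"
    then have "cut_edges n (s' t) \<subseteq> cut_edges n (p t)"
      using s[of t] d(1) p(1) by (auto simp: s'_def)
    then show "hit_cost n (s' t) (\<sigma> ! t) \<le> hit_cost n (p t) (\<sigma> ! t)"
      by (auto simp: hit_cost_def)
  qed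
  moreover have "?H p \<le> 20 * k * ?H p" using k by simp
  moreover have "total_cost n c0 s' \<sigma> \<le> n + (?H s' + ?M s')"
    using recolor_cost_le[of n c0 "s' 0"] by (simp add: total_cost_def sum.distrib)
  moreover have "20 * k * OPT n c0 \<sigma> = 20 * k * ?H p + 20 * k * ?M p"
    using p(1) by (simp add: opt total_cost_def sum.distrib recolor_cost_def distrib_left)
  ultimately have "total_cost n c0 s' \<sigma> \<le> 20 * k * OPT n c0 \<sigma> + 4 * n"
    using cost by linarith
  moreover have "s' 0 = d" by (simp add: s'_def)
  moreover have "\<forall>t\<le>?T. balanced n (3 / 2 + 1 / real k) (s' t) \<and> card (cut_edges n (s' t)) \<le> 2 * k"
    using s d by (auto simp: s'_def)
  ultimately show ?thesis by blast
qed

section \<open>Recovering a colouring from its cut edges\<close>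

lemma induced_coloring_cut_edges:
  assumes "0 < n" "i < n"
  shows "induced_coloring (c 0) (cut_edges n c) i = c i"
  using assms(2)
proof (induction i)
  case 0
  then show ?case by (simp add: induced_coloring_def)
next
  case (Suc i)
  have "finite (cut_edges n c)" by (simp add: cut_edges_def)
  moreover have "i \<in> cut_edges n c \<longleftrightarrow> c i \<noteq> c (Suc i)"
    using Suc.prems by (simp add: cut_edges_def)
  ultimately show ?case
    using Suc by (auto simp: induced_coloring_def card_less_Suc)
qed

text \<open>A full turn around the cycle returns to the colour of node \<open>0\<close>, so the
  number of colour flips is even.\<close>

lemma even_card_cut_edges:
  assumes "0 < n"
  shows "even (card (cut_edges n c))"
proof -
  obtain m where m: "n = Suc m" using assms by (cases n) auto
  let ?C = "cut_edges n c"
  have fin: "finite ?C" by (simp add: cut_edges_def)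
  have "{j \<in> ?C. j < Suc m} = ?C" using m by (auto simp: cut_edges_def)
  moreover have "m \<in> ?C \<longleftrightarrow> c m \<noteq> c 0" using m by (simp add: cut_edges_def)
  ultimately show ?thesis
    using induced_coloring_cut_edges[OF assms, of m c] card_less_Suc[OF fin, of m] m
    by (auto simp: induced_coloring_def split: if_splits)
qed

text \<open>Makes the specification of the rebalancing procedure applicable to the cut edges of the
  initial colouring.\<close>

lemma induces_balanced_cut_edges:
  assumes "0 < n" "balanced n \<alpha> c"
  shows "induces_balanced n \<alpha> (cut_edges n c)"
proof -
  have "balanced n \<alpha> (induced_coloring (c 0) (cut_edges n c))"
  proof -
    have "{i. i < n \<and> induced_coloring (c 0) (cut_edges n c) i = x} = {i. i < n \<and> c i = x}" for x
      using induced_coloring_cut_edges[OF assms(1)] by auto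
    then show ?thesis using assms(2) unfolding balanced_def by simp
  qed
  then have "balanced n \<alpha> (induced_coloring True (cut_edges n c))"
    using balanced_induced_coloring_swap[of n \<alpha> "c 0"] by (cases "c 0") auto
  then show ?thesis
    using even_card_cut_edges[OF assms(1)]
    by (auto simp: induces_balanced_def valid_cut_set_def cut_edges_def)
qed

section \<open>The offline algorithm\<close>

theorem theorem2:
  "\<exists>C1 C2 :: real. \<forall>(n::nat) (k::nat) (c0::coloring) (G :: nat set \<Rightarrow> nat set) (b::bool).
     n > 0 \<and> even n \<and> k \<ge> 1 \<and> balanced n 1 c0 \<and> global_rebalancing n k G \<longrightarrow>
       (\<exists>OFF \<in> alg_class n k (3 / 2 + 1 / real k) G b c0.
          \<forall>\<sigma>\<in>request_seqs n.
            real (total_cost n c0 (OFF \<sigma>) \<sigma>) \<le> C1 * real k * real (OPT n c0 \<sigma>) + C2 * real n)"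
proof (rule exI[of _ 20], rule exI[of _ 4], intro allI impI, elim conjE)
  fix n k :: nat and c0 :: coloring and G :: "nat set \<Rightarrow> nat set" and b :: bool
  assume n: "0 < n" and k: "1 \<le> k" and bal: "balanced n 1 c0" and G: "global_rebalancing n k G"
  let ?C = "G (cut_edges n c0)"
  let ?d = "induced_coloring b ?C"
  have C: "?C \<subseteq> cut_edges n c0" "card ?C \<le> 2 * k" "induces_balanced n (1 + 1 / real k) ?C"
    using G induces_balanced_cut_edges[OF n bal] unfolding global_rebalancing_def by auto
  then have "valid_cut_set n ?C" and "balanced n (1 + 1 / real k) (induced_coloring True ?C)"
    by (auto simp: induces_balanced_def)
  then have cuts: "cut_edges n ?d = ?C" and bal_d: "balanced n (1 + 1 / real k) ?d"
    using cut_edges_induced_coloring balanced_induced_coloring_swap[of n _ True]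
    by (auto, cases b, auto)
  have "(1 + 1 / real k) * real n / 2 \<le> (3 / 2 + 1 / real k) * real n / 2"
    by (intro divide_right_mono mult_right_mono) auto
  then have "balanced n (3 / 2 + 1 / real k) ?d"
    using bal_d unfolding balanced_def by (meson order_trans)
  \<comment> \<open>An offline algorithm sees the whole sequence, so it is obtained by choosing one
    schedule for each \<open>\<sigma>\<close>.\<close>
  then have "\<forall>\<sigma>. \<exists>s. s 0 = ?d \<and>
      (\<forall>t\<le>length \<sigma>. balanced n (3 / 2 + 1 / real k) (s t) \<and> card (cut_edges n (s t)) \<le> 2 * k) \<and>
      total_cost n c0 s \<sigma> \<le> 20 * k * OPT n c0 \<sigma> + 4 * n"
    using offline_schedule[OF n k bal, of ?d] C cuts by auto
  then obtain OFF where OFF: "\<And>\<sigma>. OFF \<sigma> 0 = ?d"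
      "\<And>\<sigma> t. t \<le> length \<sigma> \<Longrightarrow>
        balanced n (3 / 2 + 1 / real k) (OFF \<sigma> t) \<and> card (cut_edges n (OFF \<sigma> t)) \<le> 2 * k"
      "\<And>\<sigma>. total_cost n c0 (OFF \<sigma>) \<sigma> \<le> 20 * k * OPT n c0 \<sigma> + 4 * n"
    by metis
  have "OFF \<in> alg_class n k (3 / 2 + 1 / real k) G b c0"
    using OFF(1,2) unfolding alg_class_def by blast
  moreover have "real (total_cost n c0 (OFF \<sigma>) \<sigma>) \<le> 20 * real k * real (OPT n c0 \<sigma>) + 4 * real n" for \<sigma>
    using of_nat_mono[OF OFF(3)[of \<sigma>], where 'a = real] by simp
  ultimately show "\<exists>OFF \<in> alg_class n k (3 / 2 + 1 / real k) G b c0.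
      \<forall>\<sigma>\<in>request_seqs n.
        real (total_cost n c0 (OFF \<sigma>) \<sigma>) \<le> 20 * real k * real (OPT n c0 \<sigma>) + 4 * real n"
    by blast
qed

end
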